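(* Let $n \geq 2$ be an integer. Then there exists a finite matroid $M$ with flatness degree $\phi(M) = n$. Moreover, there exists a gammoid $M$ with flatness degree $\phi(M) = n$.
   Context: Let $M$ be a finite matroid with ground set $N$, rank function $r$ and set of flats $\mathcal{F}$ (sets $F$ with $r(F\cup\{x\})>r(F)$ for all $x\notin F$). For a finite collection (multiset) of flats $\mathcal{C} = \{F_i : i \in I\}$ put $F_S = \bigcap_{i\in S}F_i$ for $\emptyset\neq S\subseteq I$, $F_\emptyset = \bigcup_{i\in I}F_i$, and $\Delta(\mathcal{C}) = \sum_{S\subseteq I}(-1)^{|S|} r(F_S)$. $M$ is $k$-flat if $\Delta(\mathcal{C})\le 0$ for every collection $\mathcal{C}$ of flats with $|\mathcal{C}|\le k$. The flatness degree $\phi(M)$ is the integer $k$ such that $M$ is $k$-flat but not $(k+1)$-flat (and $\phi(M)=\omega$ if $M$ is $k$-flat for all $k$). A gammoid is a matroid obtained as follows: take a finite directed graph with vertex set $V$ and subsets $N_1, N_2 \subseteq V$; the matroid on $N_1$ has as independent sets those $I \subseteq N_1$ for which there is a collection of $|I|$ pairwise vertex-disjoint directed paths, each starting at a vertex of $I$ and ending at a vertex of $N_2$. *)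

theory Defs
  imports
    "Graph_Theory.Pair_Digraph"
    "Graph_Theory.Vertex_Walk"
    "HOL-Library.Extended_Nat"
begin

locale matroid =
  fixes carrier :: "'a set" and indep :: "'a set \<Rightarrow> bool"
  assumes carrier_finite: "finite carrier"
    and indep_subset_carrier: "indep X \<Longrightarrow> X \<subseteq> carrier"
    and indep_empty: "indep {}"
    and indep_subset: "indep X \<Longrightarrow> Y \<subseteq> X \<Longrightarrow> indep Y"
    and augment: "indep X \<Longrightarrow> indep Y \<Longrightarrow> card X = Suc (card Y) \<Longrightarrow>
      \<exists>x\<in>X - Y. indep (insert x Y)"

definition matroid_rank :: "('a set \<Rightarrow> bool) \<Rightarrow> 'a set \<Rightarrow> nat" where
  "matroid_rank indep X = Max {card Y | Y. Y \<subseteq> X \<and> indep Y}"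

definition flat :: "'a set \<Rightarrow> ('a set \<Rightarrow> bool) \<Rightarrow> 'a set \<Rightarrow> bool" where
  "flat N indep F \<longleftrightarrow>
     F \<subseteq> N \<and> (\<forall>x\<in>N - F. matroid_rank indep (insert x F) > matroid_rank indep F)"

definition family_meet :: "'i set \<Rightarrow> ('i \<Rightarrow> 'a set) \<Rightarrow> 'i set \<Rightarrow> 'a set" where
  "family_meet I F S = (if S = {} then (\<Union>i\<in>I. F i) else (\<Inter>i\<in>S. F i))"

definition flat_Delta :: "('a set \<Rightarrow> bool) \<Rightarrow> 'i set \<Rightarrow> ('i \<Rightarrow> 'a set) \<Rightarrow> int" where
  "flat_Delta indep I F =
     (\<Sum>S\<in>Pow I. (-1) ^ card S * int (matroid_rank indep (family_meet I F S)))"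

(* A finite multiset of flats is a family indexed by a finite set; the family need not be
   injective, and every finite index set can be taken to consist of natural numbers. *)
definition k_flat :: "nat \<Rightarrow> 'a set \<Rightarrow> ('a set \<Rightarrow> bool) \<Rightarrow> bool" where
  "k_flat k N indep \<longleftrightarrow>
     (\<forall>(I :: nat set) F. finite I \<and> card I \<le> k \<and> (\<forall>i\<in>I. flat N indep (F i)) \<longrightarrow>
        flat_Delta indep I F \<le> 0)"

(* The value \<infinity> plays the role of \<omega>. *)
definition flatness_degree :: "'a set \<Rightarrow> ('a set \<Rightarrow> bool) \<Rightarrow> enat" where
  "flatness_degree N indep =
     (if \<forall>k. k_flat k N indep then \<infinity>
      else enat (THE k. k_flat k N indep \<and> \<not> k_flat (Suc k) N indep))"

(* vpath: nonempty list of distinct vertices, consecutive ones joined by arcs. Paths consisting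
   of a single vertex are allowed. *)
definition linked_into :: "'a pair_pre_digraph \<Rightarrow> 'a set \<Rightarrow> 'a set \<Rightarrow> bool" where
  "linked_into G I B \<longleftrightarrow>
     (\<exists>P. finite P \<and> card P = card I \<and>
        (\<forall>p\<in>P. vpath p (with_proj G) \<and> hd p \<in> I \<and> last p \<in> B) \<and>
        (\<forall>p\<in>P. \<forall>q\<in>P. p \<noteq> q \<longrightarrow> set p \<inter> set q = {}))"

(* The vertices of the digraph live in the same type as the ground set; over an infinite type
   this does not restrict the digraphs that can be used. *)
definition gammoid :: "'a set \<Rightarrow> ('a set \<Rightarrow> bool) \<Rightarrow> bool" where
  "gammoid N indep \<longleftrightarrow> matroid N indep \<and>
     (\<exists>G B. pair_fin_digraph G \<and> N \<subseteq> pverts G \<and> B \<subseteq> pverts G \<and>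
        (\<forall>I. indep I \<longleftrightarrow> I \<subseteq> N \<and> linked_into G I B))"

lemma k_flat_mono: "k_flat k N indep \<Longrightarrow> j \<le> k \<Longrightarrow> k_flat j N indep"
  unfolding k_flat_def using le_trans by blast

lemma (in matroid) matroid_rank_empty: "matroid_rank indep {} = 0"
proof -
  have "{card Y | Y. Y \<subseteq> {} \<and> indep Y} = {0}"
    using indep_empty by auto
  then show ?thesis
    unfolding matroid_rank_def by (metis Max_singleton)
qed

lemma (in matroid) k_flat_0: "k_flat 0 carrier indep"
  unfolding k_flat_def
proof (intro allI impI)
  fix I :: "nat set" and F :: "nat \<Rightarrow> 'a set"
  assume "finite I \<and> card I \<le> 0 \<and> (\<forall>i\<in>I. flat carrier indep (F i))"
  then have "I = {}" by (metis card_0_eq le_zero_eq)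
  then show "flat_Delta indep I F \<le> 0"
    by (simp add: flat_Delta_def family_meet_def matroid_rank_empty)
qed

(* The definite description in flatness_degree always refers. *)
lemma flatness_degree_eq_enatI:
  assumes "k_flat k N indep" "\<not> k_flat (Suc k) N indep"
  shows "flatness_degree N indep = enat k"
proof -
  have "(THE j. k_flat j N indep \<and> \<not> k_flat (Suc j) N indep) = k"
  proof (rule the_equality)
    fix j assume j: "k_flat j N indep \<and> \<not> k_flat (Suc j) N indep"
    show "j = k"
    proof (rule ccontr)
      assume "j \<noteq> k"
      then have "Suc j \<le> k \<or> Suc k \<le> j" by linarith
      with j assms show False
        using k_flat_mono[of j N indep "Suc k"] k_flat_mono[of k N indep "Suc j"] by blast
    qed
  qed (use assms in blast)
  moreover have "\<not> (\<forall>k. k_flat k N indep)"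
    using assms(2) by blast
  ultimately show ?thesis by (simp add: flatness_degree_def)
qed

lemma (in matroid) flatness_degree_eq_enat_iff:
  "flatness_degree carrier indep = enat k \<longleftrightarrow>
     k_flat k carrier indep \<and> \<not> k_flat (Suc k) carrier indep"
proof
  assume eq: "flatness_degree carrier indep = enat k"
  have "\<not> (\<forall>j. k_flat j carrier indep)"
  proof
    assume "\<forall>j. k_flat j carrier indep"
    with eq show False by (simp add: flatness_degree_def)
  qed
  moreover have "k_flat j carrier indep"
    if step: "\<And>i. k_flat i carrier indep \<Longrightarrow> k_flat (Suc i) carrier indep" for j
    by (induction j) (simp_all add: k_flat_0 step)
  ultimately obtain j where j: "k_flat j carrier indep" "\<not> k_flat (Suc j) carrier indep"
    by blast
  with flatness_degree_eq_enatI[OF j] eq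
  show "k_flat k carrier indep \<and> \<not> k_flat (Suc k) carrier indep"
    by simp
qed (simp add: flatness_degree_eq_enatI)

end

theory Submission
  imports Defs
begin

text \<open>
  Split a set \<open>E\<close> of size \<open>n (n + 1)\<close> into \<open>n + 1\<close> blocks of size \<open>n\<close>, and let \<open>M\<close> be the sparse paving
  matroid of rank \<open>n\<^sup>2\<close> on \<open>E\<close> whose circuit-hyperplanes are the complements of the blocks. By
  inclusion-exclusion, \<open>\<Delta>\<close> is minus the alternating sum of the nullities of the intersections. A
  family containing \<open>E\<close> has \<open>\<Delta> = 0\<close>; for any other family \<open>\<Delta>\<close> is the number \<open>t\<close> of distinct
  circuit-hyperplanes in it minus the nullity of its union. If \<open>t \<ge> 2\<close>, the union is \<open>E\<close>, of nullity
  \<open>n\<close>, so \<open>\<Delta> > 0\<close> exactly when all \<open>n + 1\<close> circuit-hyperplanes occur.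

  \<open>M\<close> is transversal, hence a gammoid: give each block a private vertex adjacent to all elements of
  that block, and add \<open>n\<^sup>2 - n - 1\<close> vertices adjacent to all of \<open>E\<close>.
\<close>

section \<open>Alternating sums over subsets\<close>

text \<open>Each factor \<open>(-1) + 1\<close> of a product over the nonempty set \<open>T\<close>
  is zero; expanding the product gives the signed sum over subsets.\<close>

lemma sum_Pow_alternating:
  assumes "finite T" "T \<noteq> {}"
  shows "(\<Sum>S\<in>Pow T. (-1) ^ card S) = (0 :: int)"
proof -
  have "(0 :: int) = (\<Prod>x\<in>T. (-1) + 1)"
    using assms by (simp add: card_gt_0_iff)
  also have "\<dots> = (\<Sum>S\<in>Pow T. (-1) ^ card S)"
    using assms by (subst prod_add) simp_all
  finally show ?thesis ..
qed

text \<open>After exchanging the sums, each \<open>x\<close> contributes the alternating sum over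
  the subsets of the nonempty \<open>T x\<close>, hence zero. It serves twice: with
  \<open>T x\<close> the indices of the sets containing an element, and with the indices at which a
  circuit-hyperplane occurs.\<close>

lemma sum_Pow_alternating_card_eq_0:
  assumes "finite I" "finite X" "\<And>x. x \<in> X \<Longrightarrow> T x \<subseteq> I" "\<And>x. x \<in> X \<Longrightarrow> T x \<noteq> {}"
  shows "(\<Sum>S\<in>Pow I. (-1) ^ card S * int (card {x \<in> X. S \<subseteq> T x})) = 0"
proof -
  have "(\<Sum>S\<in>Pow I. (-1) ^ card S * int (card {x \<in> X. S \<subseteq> T x}))
      = (\<Sum>S\<in>Pow I. \<Sum>x\<in>X. if S \<subseteq> T x then (-1) ^ card S else 0)"
    using assms(2) by (intro sum.cong) (simp_all add: sum.If_cases Int_def)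
  also have "\<dots> = (\<Sum>x\<in>X. \<Sum>S\<in>Pow I. if S \<subseteq> T x then (-1) ^ card S else 0)"
    by (rule sum.swap)
  also have "\<dots> = (\<Sum>x\<in>X. 0)"
  proof (rule sum.cong[OF refl])
    fix x assume x: "x \<in> X"
    have "(\<Sum>S\<in>Pow I. if S \<subseteq> T x then (-1) ^ card S else 0) = (\<Sum>S\<in>Pow (T x). (-1) ^ card S :: int)"
      using assms(1) assms(3)[OF x] by (intro sum.mono_neutral_cong_right) auto
    also have "\<dots> = 0"
      using x assms by (intro sum_Pow_alternating) (auto intro: finite_subset)
    finally show "(\<Sum>S\<in>Pow I. if S \<subseteq> T x then (-1) ^ card S else 0 :: int) = 0" .
  qed
  finally show ?thesis by simp
qed

lemma family_meet_subset_UN: "S \<subseteq> I \<Longrightarrow> family_meet I F S \<subseteq> (\<Union>i\<in>I. F i)"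
  by (auto simp: family_meet_def)

lemma mem_family_meet_iff:
  assumes "S \<subseteq> I" "x \<in> (\<Union>i\<in>I. F i)"
  shows "x \<in> family_meet I F S \<longleftrightarrow> S \<subseteq> {i \<in> I. x \<in> F i}"
  using assms by (auto simp: family_meet_def)

text \<open>By inclusion-exclusion, the rank may be replaced by the negated nullity.\<close>

lemma flat_Delta_eq_nullity:
  assumes "finite I" "\<And>i. i \<in> I \<Longrightarrow> finite (F i)"
  shows "flat_Delta indep I F =
    - (\<Sum>S\<in>Pow I. (-1) ^ card S *
        (int (card (family_meet I F S)) - int (matroid_rank indep (family_meet I F S))))"
proof -
  let ?U = "\<Union>i\<in>I. F i"
  have "(\<Sum>S\<in>Pow I. (-1) ^ card S * int (card (family_meet I F S)))
      = (\<Sum>S\<in>Pow I. (-1) ^ card S * int (card {x \<in> ?U. S \<subseteq> {i \<in> I. x \<in> F i}}))"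
  proof (rule sum.cong[OF refl])
    fix S assume "S \<in> Pow I"
    then have "family_meet I F S = {x \<in> ?U. S \<subseteq> {i \<in> I. x \<in> F i}}"
      using family_meet_subset_UN[of S I F] mem_family_meet_iff[of S I _ F] by blast
    then show "(-1) ^ card S * int (card (family_meet I F S))
      = (-1) ^ card S * int (card {x \<in> ?U. S \<subseteq> {i \<in> I. x \<in> F i}})"
      by simp
  qed
  also have "\<dots> = 0"
    using assms by (intro sum_Pow_alternating_card_eq_0) auto
  finally show ?thesis
    by (simp add: flat_Delta_def right_diff_distrib sum_subtractf)
qed

text \<open>The terms of \<open>S\<close> and of the symmetric difference of \<open>S\<close> and \<open>{j}\<close> cancel.\<close>

lemma flat_Delta_eq_0_if_greatest:
  assumes "finite I" "j \<in> I" "\<And>i. i \<in> I \<Longrightarrow> F i \<subseteq> F j"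
  shows "flat_Delta indep I F = 0"
proof -
  define J where "J = I - {j}"
  have I: "I = insert j J" and j: "j \<notin> J" and fin: "finite J"
    using assms(1,2) by (auto simp: J_def)
  let ?r = "\<lambda>S. int (matroid_rank indep (family_meet I F S))"
  have eq: "?r (insert j S) = ?r S" if S: "S \<in> Pow J" for S
  proof -
    \<comment> \<open>The case \<open>S = {}\<close> is the convention for the empty index set: the
      meet is then the union of the family, which equals \<open>F j\<close>.\<close>
    have "family_meet I F (insert j S) = family_meet I F S"
    proof (cases "S = {}")
      case True
      have "(\<Union>i\<in>I. F i) = F j"
        using assms(2,3) by blast
      with True show ?thesis
        by (simp add: family_meet_def)
    next
      case False
      then obtain i where "i \<in> S" "i \<in> I"
        using S unfolding J_def by blast
      then have "(\<Inter>i\<in>S. F i) \<subseteq> F j"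
        using assms(3) by blast
      with False show ?thesis
        by (auto simp: family_meet_def)
    qed
    then show ?thesis by simp
  qed
  have "flat_Delta indep I F = (\<Sum>S\<in>Pow J \<union> insert j ` Pow J. (-1) ^ card S * ?r S)"
    unfolding flat_Delta_def by (subst (2) I) (simp only: Pow_insert)
  also have "\<dots> = (\<Sum>S\<in>Pow J. (-1) ^ card S * ?r S)
      + (\<Sum>S\<in>insert j ` Pow J. (-1) ^ card S * ?r S)"
    using fin j by (intro sum.union_disjoint) auto
  also have "(\<Sum>S\<in>insert j ` Pow J. (-1) ^ card S * ?r S)
      = (\<Sum>S\<in>Pow J. (-1) ^ card (insert j S) * ?r (insert j S))"
    using j by (subst sum.reindex) (auto intro!: inj_onI)
  also have "\<dots> = (\<Sum>S\<in>Pow J. - ((-1) ^ card S * ?r S))"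
  proof (rule sum.cong[OF refl])
    fix S assume S: "S \<in> Pow J"
    then have "card (insert j S) = Suc (card S)"
      using fin j by (intro card_insert_disjoint) (auto intro: finite_subset)
    then show "(-1) ^ card (insert j S) * ?r (insert j S) = - ((-1) ^ card S * ?r S)"
      by (simp add: eq[OF S])
  qed
  finally show ?thesis
    by (simp add: sum_negf)
qed

section \<open>Ranks of finite sets\<close>

lemma finite_card_subsets:
  assumes "finite X"
  shows "finite {card Y |Y. Y \<subseteq> X \<and> P Y}"
proof (rule finite_subset)
  show "{card Y |Y. Y \<subseteq> X \<and> P Y} \<subseteq> card ` Pow X"
    by blast
qed (use assms in simp)

lemma matroid_rank_eqI:
  assumes "finite X" "Y \<subseteq> X" "indep Y" "\<And>Z. Z \<subseteq> X \<Longrightarrow> indep Z \<Longrightarrow> card Z \<le> card Y"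
  shows "matroid_rank indep X = card Y"
  unfolding matroid_rank_def
proof (rule Max_eqI)
  show "finite {card Y |Y. Y \<subseteq> X \<and> indep Y}"
    using assms(1) by (rule finite_card_subsets)
qed (use assms in auto)

lemma (in matroid) matroid_rank_le_card:
  assumes "finite X"
  shows "matroid_rank indep X \<le> card X"
proof -
  have "finite {card Y |Y. Y \<subseteq> X \<and> indep Y}"
    using assms by (rule finite_card_subsets)
  moreover have "{card Y |Y. Y \<subseteq> X \<and> indep Y} \<noteq> {}"
    using indep_empty by blast
  ultimately show ?thesis
    unfolding matroid_rank_def using assms by (subst Max_le_iff) (auto intro: card_mono)
qed

section \<open>Sparse paving matroids\<close>

text \<open>\<open>C_Int\<close> says that distinct members of \<open>C\<close> never share a subset
  of size \<open>r - 1\<close>; the members of \<open>C\<close> become the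
  circuit-hyperplanes.\<close>

locale sparse_paving =
  fixes E :: "'a set" and C :: "'a set set" and r :: nat
  assumes finite_E: "finite E"
    and r_pos: "0 < r"
    and r_less: "r < card E"
    and C_subset: "A \<in> C \<Longrightarrow> A \<subseteq> E"
    and card_C: "A \<in> C \<Longrightarrow> card A = r"
    and C_Int: "A \<in> C \<Longrightarrow> B \<in> C \<Longrightarrow> A \<noteq> B \<Longrightarrow> card (A \<inter> B) + 2 \<le> r"
begin

definition ind :: "'a set \<Rightarrow> bool" where
  "ind X \<longleftrightarrow> X \<subseteq> E \<and> card X \<le> r \<and> X \<notin> C"

abbreviation rk :: "'a set \<Rightarrow> nat" where
  "rk \<equiv> matroid_rank ind"

lemma finite_C: "finite C"
  using C_subset finite_E by (intro finite_subset[of C "Pow E"]) auto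

text \<open>Otherwise two distinct members of \<open>C\<close> would meet in \<open>Y\<close>, of
  size \<open>r - 1\<close>, against \<open>C_Int\<close>. Both augmentation and the rank of large
  sets rest on this.\<close>

lemma insert_in_C_unique:
  assumes "insert x Y \<in> C" "insert y Y \<in> C" "x \<notin> Y" "y \<notin> Y"
  shows "x = y"
proof (rule ccontr)
  assume "x \<noteq> y"
  have "finite Y"
    using assms(1) C_subset finite_E by (meson finite_subset finite_insert)
  have "Suc (card Y) = r"
    using card_C[OF assms(1)] assms(3) \<open>finite Y\<close> by simp
  moreover have "insert x Y \<inter> insert y Y = Y" "insert x Y \<noteq> insert y Y"
    using \<open>x \<noteq> y\<close> assms(3,4) by auto
  ultimately show False
    using C_Int[OF assms(1,2)] by simp
qed

lemma psubset_C_ind: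
  assumes "A \<in> C" "X \<subset> A"
  shows "ind X"
proof -
  have "card X < r"
    using assms finite_E C_subset card_C by (metis finite_subset psubset_card_mono)
  then show ?thesis
    using assms C_subset card_C by (auto simp: ind_def)
qed

lemma ind_subset:
  assumes "ind X" "Y \<subseteq> X"
  shows "ind Y"
proof -
  have fin: "finite X"
    using assms(1) finite_E by (auto simp: ind_def intro: finite_subset)
  have "Y \<notin> C"
  proof
    assume "Y \<in> C"
    then have "card X \<le> card Y"
      using assms(1) card_C by (simp add: ind_def)
    then have "X = Y"
      using card_seteq[OF fin assms(2)] by simp
    then show False
      using \<open>Y \<in> C\<close> assms(1) by (simp add: ind_def)
  qed
  then show ?thesis
    using assms card_mono[OF fin assms(2)] by (auto simp: ind_def)
qed

sublocale matroid E ind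
proof
  show "ind {}"
    using r_pos card_C[of "{}"] by (auto simp: ind_def)
  show "finite E"
    by (rule finite_E)
  show "X \<subseteq> E" if "ind X" for X
    using that by (simp add: ind_def)
  show "ind Y" if "ind X" "Y \<subseteq> X" for X Y
    using that by (rule ind_subset)
  fix X Y assume X: "ind X" and Y: "ind Y" and card: "card X = Suc (card Y)"
  have fin: "finite X" "finite Y"
    using X Y finite_E by (auto simp: ind_def intro: finite_subset)
  have "\<not> X \<subseteq> Y"
    using card card_mono[OF fin(2), of X] by auto
  then obtain x where x: "x \<in> X" "x \<notin> Y" by blast
  show "\<exists>x\<in>X - Y. ind (insert x Y)"
  proof (rule ccontr)
    assume none: "\<not> ?thesis"
    \<comment> \<open>The extension of \<open>Y\<close> by \<open>z\<close> has size
      \<open>card X\<close>, at most \<open>r\<close>, so only membership in \<open>C\<close> can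
      make it dependent. By uniqueness \<open>X\<close> then extends \<open>Y\<close> by
      \<open>x\<close> alone and would itself be in \<open>C\<close>.\<close>
    have inC: "insert z Y \<in> C" if "z \<in> X - Y" for z
      using none that X Y card fin by (auto simp: ind_def)
    have "X - Y \<subseteq> {x}"
      using insert_in_C_unique[of x Y] inC x by blast
    then have "X \<subseteq> insert x Y" by blast
    moreover have "card X = card (insert x Y)"
      using card fin x by simp
    ultimately have "X = insert x Y"
      using fin by (intro card_subset_eq) auto
    then show False
      using inC[of x] x X by (simp add: ind_def)
  qed
qed

lemma matroid_sparse_paving: "matroid E ind"
  by unfold_locales

lemma rk_ind: "ind X \<Longrightarrow> rk X = card X"
  using finite_E by (intro matroid_rank_eqI) (auto simp: ind_def intro: finite_subset card_mono)

text \<open>\<open>A\<close> is dependent, but deleting any one element leaves an independent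
  set.\<close>

lemma rk_C:
  assumes "A \<in> C"
  shows "Suc (rk A) = r"
proof -
  have fin: "finite A"
    using assms C_subset finite_E by (blast intro: finite_subset)
  obtain x where x: "x \<in> A"
    using card_C[OF assms] r_pos by fastforce
  have card: "Suc (card (A - {x})) = r"
    using card_Suc_Diff1[OF fin x] card_C[OF assms] by simp
  have "rk A = card (A - {x})"
  proof (rule matroid_rank_eqI[OF fin])
    show "ind (A - {x})"
      using assms x by (intro psubset_C_ind[of A]) auto
    fix Z assume "Z \<subseteq> A" "ind Z"
    then have "Z \<subset> A"
      using assms by (auto simp: ind_def)
    then have "card Z < card A"
      using fin by (simp add: psubset_card_mono)
    then show "card Z \<le> card (A - {x})"
      using card card_C[OF assms] by linarith
  qed auto
  with card show ?thesis by simp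
qed

text \<open>A subset \<open>Y\<close> of \<open>X\<close> of size \<open>r - 1\<close> has at least
  two one-element extensions within \<open>X\<close>, and at most one of them lies in
  \<open>C\<close>; any other has size \<open>r\<close> and is independent.\<close>

lemma rk_large:
  assumes "X \<subseteq> E" "r < card X"
  shows "rk X = r"
proof -
  have fin: "finite X"
    using assms(1) finite_E by (rule finite_subset)
  obtain Y where Y: "Y \<subseteq> X" "card Y = r - 1"
    using assms(2) by (auto intro: obtain_subset_with_card_n[of "r - 1" X])
  have finY: "finite Y"
    using Y fin finite_subset by blast
  have "card (X - Y) \<ge> 2"
    using Y assms(2) r_pos by (simp add: card_Diff_subset finY)
  then have "\<not> card (X - Y) \<le> Suc 0"
    by simp
  then obtain x y where xy: "x \<in> X - Y" "y \<in> X - Y" "x \<noteq> y"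
    using fin by (auto simp only: card_le_Suc0_iff_eq finite_Diff)
  then obtain z where z: "z \<in> X - Y" "insert z Y \<notin> C"
    using insert_in_C_unique[of x Y y] by blast
  have card: "card (insert z Y) = r"
    using z Y finY r_pos by simp
  have "rk X = card (insert z Y)"
  proof (rule matroid_rank_eqI[OF fin])
    show "ind (insert z Y)"
      using z Y card assms(1) by (auto simp: ind_def)
  qed (use z Y card in \<open>auto simp: ind_def\<close>)
  then show ?thesis
    using card by simp
qed

text \<open>A set with more than \<open>r\<close> elements already has full rank, so it can be a
  flat only if it is \<open>E\<close>.\<close>

lemma flat_cases:
  assumes "flat E ind X" "X \<noteq> E"
  shows "ind X \<or> X \<in> C"
proof (rule ccontr)
  assume neither: "\<not> ?thesis"
  have X: "X \<subseteq> E" using assms(1) by (simp add: flat_def)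
  then have large: "r < card X"
    using neither by (auto simp: ind_def)
  obtain x where x: "x \<in> E - X"
    using X assms(2) by blast
  have "card X \<le> card (insert x X)"
    using X finite_E by (meson card_insert_le finite_subset)
  then have "rk (insert x X) = rk X"
    using rk_large[OF X large] rk_large[of "insert x X"] large x X by simp
  then show False
    using assms(1) x unfolding flat_def by (metis less_irrefl)
qed

lemma flat_C:
  assumes "A \<in> C"
  shows "flat E ind A"
  unfolding flat_def
proof (intro conjI ballI)
  show "A \<subseteq> E" using assms by (rule C_subset)
  fix x assume x: "x \<in> E - A"
  have "finite A"
    using assms C_subset finite_E by (blast intro: finite_subset)
  then have "rk (insert x A) = r"
    using x C_subset[OF assms] card_C[OF assms] by (intro rk_large) auto
  then show "rk A < rk (insert x A)"
    using rk_C[OF assms] by simp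
qed

text \<open>An intersection of proper flats has nullity at most \<open>1\<close>, and it has nullity \<open>1\<close> only if all
  of them are the same circuit-hyperplane. This makes the alternating sum of the nullities of the
  proper intersections count the circuit-hyperplanes that occur in the family.\<close>

lemma flat_Delta_proper:
  assumes fin: "finite I" and flat: "\<And>i. i \<in> I \<Longrightarrow> flat E ind (F i)"
    and proper: "\<And>i. i \<in> I \<Longrightarrow> F i \<noteq> E"
  shows "flat_Delta ind I F =
    int (card (C \<inter> F ` I)) + int (rk (\<Union>i\<in>I. F i)) - int (card (\<Union>i\<in>I. F i))"
proof -
  define nu where "nu X = int (card X) - int (rk X)" for X
  define D where "D = C \<inter> F ` I"
  let ?T = "\<lambda>A. {i \<in> I. F i = A}"
  \<comment> \<open>For nonempty \<open>S\<close> inside \<open>I\<close> this is \<open>1\<close>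
    if all \<open>F i\<close> with \<open>i\<close> in \<open>S\<close> are the same member of
    \<open>C\<close>, and \<open>0\<close> otherwise; at \<open>S = {}\<close> it is
    \<open>card D\<close>.\<close>
  let ?c = "\<lambda>S. int (card {A \<in> D. S \<subseteq> ?T A})"
  have subE: "F i \<subseteq> E" if "i \<in> I" for i
    using flat[OF that] by (simp add: flat_def)
  have nu_meet: "nu (family_meet I F S) = ?c S" if S: "S \<in> Pow I - {{}}" for S
  proof (cases "\<exists>A\<in>C. S \<subseteq> ?T A")
    case True
    then obtain A where A: "A \<in> C" "S \<subseteq> ?T A" by blast
    have "F ` S = {A}"
      using A(2) S by blast
    then have "family_meet I F S = A"
      using S by (simp add: family_meet_def)
    moreover have "{A \<in> D. S \<subseteq> ?T A} = {A}"
      using A S unfolding D_def by blast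
    ultimately show ?thesis
      using rk_C[OF A(1)] card_C[OF A(1)] by (simp add: nu_def)
  next
    case False
    obtain i where i: "i \<in> S" "i \<in> I"
      using S by blast
    have meet: "family_meet I F S \<subseteq> F j" if "j \<in> S" for j
      using that by (auto simp: family_meet_def)
    have "ind (family_meet I F S)"
    \<comment> \<open>An \<open>F j\<close> outside \<open>C\<close> is independent, and so are its
      subsets. If all are in \<open>C\<close>, two distinct ones have equal size and are
      incomparable, so the meet is a proper subset of a circuit.\<close>
    proof (cases "\<exists>j\<in>S. F j \<notin> C")
      case True
      then obtain j where "j \<in> S" "F j \<notin> C" by blast
      moreover have "j \<in> I" using S \<open>j \<in> S\<close> by blast
      ultimately have "ind (F j)"
        using flat_cases[OF flat proper] by blast
      then show ?thesis
        using meet[OF \<open>j \<in> S\<close>] by (rule ind_subset)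
    next
      case all: False
      then have Fi: "F i \<in> C" using i by blast
      then obtain j where j: "j \<in> S" "F j \<noteq> F i"
        using False S by blast
      have "F j \<in> C" using all j by blast
      have "\<not> F i \<subseteq> F j"
      proof
        assume "F i \<subseteq> F j"
        then have "card (F i \<inter> F j) = r"
          using card_C[OF Fi] by (simp add: Int_absorb2)
        then show False
          using C_Int[OF Fi \<open>F j \<in> C\<close>] j by auto
      qed
      then have "family_meet I F S \<subset> F i"
        using meet[OF i(1)] meet[OF j(1)] by blast
      then show ?thesis
        by (rule psubset_C_ind[OF Fi])
    qed
    moreover have none: "{A \<in> D. S \<subseteq> ?T A} = {}"
      using False unfolding D_def by blast
    moreover have "?c S = 0"
      unfolding none by simp
    ultimately show ?thesis
      by (simp add: nu_def rk_ind)
  qed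
  \<comment> \<open>The empty index set is split off, since its meet is the union, to which
    \<open>nu_meet\<close> does not apply; completing the remaining sum of \<open>?c\<close> costs
    \<open>?c {}\<close>.\<close>
  have "(\<Sum>S\<in>Pow I. (-1) ^ card S * nu (family_meet I F S))
      = nu (family_meet I F {}) + (\<Sum>S\<in>Pow I - {{}}. (-1) ^ card S * nu (family_meet I F S))"
    using fin by (subst sum.remove[of _ "{}"]) auto
  also have "\<dots> = nu (family_meet I F {}) + (\<Sum>S\<in>Pow I - {{}}. (-1) ^ card S * ?c S)"
    using nu_meet by simp
  also have "(\<Sum>S\<in>Pow I - {{}}. (-1) ^ card S * ?c S)
      = (\<Sum>S\<in>Pow I. (-1) ^ card S * ?c S) - ?c {}"
    using fin by (subst sum.remove[of "Pow I" "{}"]) auto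
  also have "(\<Sum>S\<in>Pow I. (-1) ^ card S * ?c S) = 0"
    using fin by (intro sum_Pow_alternating_card_eq_0) (auto simp: D_def)
  also have "?c {} = int (card D)"
    by simp
  finally have "(\<Sum>S\<in>Pow I. (-1) ^ card S * nu (family_meet I F S))
      = nu (\<Union>i\<in>I. F i) - int (card D)"
    by (simp add: family_meet_def)
  moreover have "flat_Delta ind I F = - (\<Sum>S\<in>Pow I. (-1) ^ card S * nu (family_meet I F S))"
    unfolding nu_def
    using fin subE finite_E by (intro flat_Delta_eq_nullity) (auto intro: finite_subset)
  ultimately show ?thesis
    by (simp add: nu_def D_def)
qed

text \<open>Here \<open>n\<close> is the nullity of \<open>E\<close>, so the count in
  \<open>flat_Delta_proper\<close> can exceed the nullity of the union only when all
  \<open>Suc n\<close> members of \<open>C\<close> occur.\<close>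

lemma flatness_degree_covering:
  assumes cover: "\<And>A B. A \<in> C \<Longrightarrow> B \<in> C \<Longrightarrow> A \<noteq> B \<Longrightarrow> A \<union> B = E"
    and E: "card E = r + n" and C: "card C = Suc n"
  shows "flatness_degree E ind = enat n"
proof (rule flatness_degree_eq_enatI)
  have UN: "(\<Union>i\<in>I. F i) = E"
    if "2 \<le> card (C \<inter> F ` I)" "\<And>i. i \<in> I \<Longrightarrow> F i \<subseteq> E" for I :: "nat set" and F
  proof -
    have "finite (C \<inter> F ` I)" "\<not> card (C \<inter> F ` I) \<le> Suc 0"
      using that(1) finite_C by auto
    then obtain A B where "A \<in> C \<inter> F ` I" "B \<in> C \<inter> F ` I" "A \<noteq> B"
      by (auto simp only: card_le_Suc0_iff_eq)
    with cover[of A B] that(2) show ?thesis by blast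
  qed
  have n: "0 < n" using E r_less by simp
  show "k_flat n E ind"
    unfolding k_flat_def
  proof (intro allI impI, elim conjE)
    fix I :: "nat set" and F
    assume I: "finite I" "card I \<le> n" and "\<forall>i\<in>I. flat E ind (F i)"
    then have flat: "\<And>i. i \<in> I \<Longrightarrow> flat E ind (F i)" by blast
    then have subE: "\<And>i. i \<in> I \<Longrightarrow> F i \<subseteq> E" by (simp add: flat_def)
    then have UE: "(\<Union>i\<in>I. F i) \<subseteq> E" by blast
    have finU: "finite (\<Union>i\<in>I. F i)"
      using UE finite_E by (rule finite_subset)
    show "flat_Delta ind I F \<le> 0"
    proof (cases "E \<in> F ` I")
      case True
      then obtain j where "j \<in> I" "F j = E" by blast
      then show ?thesis
        using flat_Delta_eq_0_if_greatest[OF I(1), of j F ind] subE by simp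
    next
      case False
      then have Delta: "flat_Delta ind I F =
          int (card (C \<inter> F ` I)) + int (rk (\<Union>i\<in>I. F i)) - int (card (\<Union>i\<in>I. F i))"
        using flat by (intro flat_Delta_proper[OF I(1)]) auto
      have t: "card (C \<inter> F ` I) \<le> n"
        using I card_image_le[OF I(1), of F] card_mono[of "F ` I" "C \<inter> F ` I"] by simp
      \<comment> \<open>In the three cases the nullity of the union is at least \<open>0\<close>, at
        least \<open>1\<close> because the union contains a circuit, and exactly \<open>n\<close>
        because the union is \<open>E\<close>.\<close>
      consider "card (C \<inter> F ` I) = 0" | "card (C \<inter> F ` I) = 1" | "2 \<le> card (C \<inter> F ` I)"
        by linarith
      then show ?thesis
      proof cases
        case 1
        have "rk (\<Union>i\<in>I. F i) \<le> card (\<Union>i\<in>I. F i)"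
          by (rule matroid_rank_le_card[OF finU])
        with 1 Delta show ?thesis by simp
      next
        case 2
        then obtain A where "C \<inter> F ` I = {A}"
          by (rule card_1_singletonE)
        then have "A \<in> C \<inter> F ` I" by simp
        then have A: "A \<in> C" "A \<subseteq> (\<Union>i\<in>I. F i)" by blast+
        have "rk (\<Union>i\<in>I. F i) < card (\<Union>i\<in>I. F i)"
        proof (cases "A = (\<Union>i\<in>I. F i)")
          case True
          then show ?thesis
            using rk_C[OF A(1)] card_C[OF A(1)] by simp
        next
          case False
          then have "r < card (\<Union>i\<in>I. F i)"
            using A finU card_C[OF A(1)] by (metis psubsetI psubset_card_mono)
          then show ?thesis
            using rk_large[OF UE] by simp
        qed
        with 2 Delta show ?thesis by simp
      next
        case 3
        then have "(\<Union>i\<in>I. F i) = E"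
          using subE by (rule UN)
        then show ?thesis
          using Delta t E rk_large[OF order_refl r_less] by simp
      qed
    qed
  qed
  show "\<not> k_flat (Suc n) E ind"
  proof
    assume kf: "k_flat (Suc n) E ind"
    \<comment> \<open>The violating family lists each member of \<open>C\<close> once and has value
      \<open>Suc n - n\<close>.\<close>
    obtain F where F: "bij_betw F {..<Suc n} C"
      using ex_bij_betw_nat_finite[OF finite_C] C by (auto simp: atLeast0LessThan)
    then have im: "F ` {..<Suc n} = C"
      by (simp add: bij_betw_def)
    have flat: "flat E ind (F i)" if "i \<in> {..<Suc n}" for i
      using that im by (intro flat_C) blast
    have proper: "F i \<noteq> E" if "i \<in> {..<Suc n}" for i
    proof -
      have "F i \<in> C" using that im by blast
      then show ?thesis using card_C r_less by fastforce
    qed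
    \<comment> \<open>Positivity of \<open>n\<close> provides the two distinct members that
      \<open>UN\<close> asks for.\<close>
    have "(\<Union>i\<in>{..<Suc n}. F i) = E"
      using flat n C by (intro UN) (auto simp: flat_def im)
    moreover have "C \<inter> F ` {..<Suc n} = C"
      using im by simp
    ultimately have "flat_Delta ind {..<Suc n} F = int (card C) + int (rk E) - int (card E)"
      using flat_Delta_proper[where F = F, OF finite_lessThan flat proper] by simp
    also have "\<dots> = 1"
      using C E rk_large[OF order_refl r_less] by simp
    finally have "flat_Delta ind {..<Suc n} F = 1" .
    moreover have "flat_Delta ind {..<Suc n} F \<le> 0"
      using kf flat unfolding k_flat_def by simp
    ultimately show False by simp
  qed
qed

end

section \<open>Transversal matroids as gammoids\<close>

text \<open>All arcs run from \<open>E\<close> to \<open>B\<close>, so a path from \<open>E\<close>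
  to \<open>B\<close> is a single arc, and disjoint paths form a matching.\<close>

lemma linked_into_bipartite_iff:
  assumes "finite I" "I \<subseteq> E" "E \<inter> B = {}" "R \<subseteq> E \<times> B"
  shows "linked_into \<lparr>pverts = E \<union> B, parcs = R\<rparr> I B \<longleftrightarrow>
    (\<exists>f. inj_on f I \<and> (\<forall>x\<in>I. (x, f x) \<in> R))"
    (is "linked_into ?G I B \<longleftrightarrow> _")
proof
  assume "linked_into ?G I B"
  then obtain P where P: "finite P" "card P = card I"
    "\<forall>p\<in>P. vpath p (with_proj ?G) \<and> hd p \<in> I \<and> last p \<in> B"
    and disj: "\<forall>p\<in>P. \<forall>q\<in>P. p \<noteq> q \<longrightarrow> set p \<inter> set q = {}"
    unfolding linked_into_def by (elim exE conjE)
  have arc: "p = [hd p, last p] \<and> (hd p, last p) \<in> R" if "p \<in> P" for p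
  proof -
    have p: "vpath p (with_proj ?G)" "hd p \<in> E" "last p \<in> B"
      using P(3) that assms(2) by auto
    then have arcs: "set (vwalk_arcs p) \<subseteq> R" "p \<noteq> []"
      by (auto simp: vpath_def vwalk_def)
    \<comment> \<open>A one-vertex path would put its vertex in both \<open>E\<close> and
      \<open>B\<close>; after two vertices the path is in \<open>B\<close>, where no arc
      starts.\<close>
    obtain x y zs where xy: "p = x # y # zs"
      using p(2,3) arcs(2) assms(3) by (cases p rule: vwalk_arcs.cases) auto
    have "(x, y) \<in> R"
      using arcs(1) by (simp add: xy)
    then have "y \<notin> E"
      using assms(3,4) by blast
    then have "zs = []"
      using arcs(1) assms(4) by (cases zs) (auto simp: xy)
    with \<open>(x, y) \<in> R\<close> show ?thesis
      by (simp add: xy)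
  qed
  have same: "p = q" if "p \<in> P" "q \<in> P" "hd p = hd q \<or> last p = last q" for p q
  proof (rule ccontr)
    assume "p \<noteq> q"
    then have "set p \<inter> set q = {}"
      using disj that(1,2) by blast
    moreover have "{hd p, last p} = set p" "{hd q, last q} = set q"
      using arc[OF that(1)] arc[OF that(2)] by (metis list.set(1,2))+
    ultimately show False
      using that(3) by blast
  qed
  then have inj: "inj_on hd P" "inj_on last P"
    by (auto intro: inj_onI)
  \<comment> \<open>Disjointness makes \<open>hd\<close> injective, so
    \<open>card P = card I\<close> forces every vertex of \<open>I\<close> to start a path.\<close>
  have "hd ` P = I"
    using P assms(1) inj(1) by (intro card_subset_eq) (auto simp: card_image)
  define g where "g = inv_into P hd"
  have g: "g x \<in> P" "hd (g x) = x" if "x \<in> I" for x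
    using that \<open>hd ` P = I\<close> by (auto simp: g_def inv_into_into f_inv_into_f)
  have "inj_on (\<lambda>x. last (g x)) I"
    using g inj(2) by (metis (no_types, lifting) inj_onD inj_onI)
  moreover have "\<forall>x\<in>I. (x, last (g x)) \<in> R"
    using g arc by metis
  ultimately show "\<exists>f. inj_on f I \<and> (\<forall>x\<in>I. (x, f x) \<in> R)"
    by blast
next
  assume "\<exists>f. inj_on f I \<and> (\<forall>x\<in>I. (x, f x) \<in> R)"
  then obtain f where f: "inj_on f I" "\<And>x. x \<in> I \<Longrightarrow> (x, f x) \<in> R" by blast
  have fB: "x \<in> E" "f x \<in> B" if "x \<in> I" for x
    using f(2)[OF that] assms(4) by auto
  let ?P = "(\<lambda>x. [x, f x]) ` I"
  have "card ?P = card I"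
    by (rule card_image) (auto intro: inj_onI)
  moreover have "vpath p (with_proj ?G) \<and> hd p \<in> I \<and> last p \<in> B" if "p \<in> ?P" for p
    using that f(2) fB assms(3) by (fastforce simp: vpath_def vwalk_def)
  moreover have "set p \<inter> set q = {}" if pq: "p \<in> ?P" "q \<in> ?P" "p \<noteq> q" for p q
  proof -
    obtain x y where xy: "x \<in> I" "y \<in> I" "p = [x, f x]" "q = [y, f y]"
      using pq(1,2) by blast
    then have "x \<noteq> y" using pq(3) by auto
    then have "f x \<noteq> f y" using f(1) xy by (auto dest: inj_onD)
    moreover have "x \<noteq> f y" "f x \<noteq> y"
      using fB xy assms(3) by blast+
    ultimately show ?thesis using xy \<open>x \<noteq> y\<close> by auto
  qed
  ultimately show "linked_into ?G I B"
    unfolding linked_into_def using assms(1) by (intro exI[of _ ?P]) auto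
qed

lemma gammoid_bipartite:
  assumes "matroid E indep" "finite B" "E \<inter> B = {}" "R \<subseteq> E \<times> B"
    and "\<And>I. I \<subseteq> E \<Longrightarrow> indep I \<longleftrightarrow> (\<exists>f. inj_on f I \<and> (\<forall>x\<in>I. (x, f x) \<in> R))"
  shows "gammoid E indep"
proof -
  let ?G = "\<lparr>pverts = E \<union> B, parcs = R\<rparr>"
  interpret matroid E indep by fact
  have "finite R"
    using assms(2,4) carrier_finite by (meson finite_SigmaI finite_subset)
  then have G: "pair_fin_digraph ?G"
    using assms(2,4) carrier_finite by unfold_locales auto
  have "indep I \<longleftrightarrow> I \<subseteq> E \<and> linked_into ?G I B" for I
  proof (cases "I \<subseteq> E")
    case True
    have fin: "finite I"
      using True carrier_finite by (rule finite_subset)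
    have "indep I \<longleftrightarrow> linked_into ?G I B"
      unfolding linked_into_bipartite_iff[OF fin True assms(3,4)] by (rule assms(5)[OF True])
    with True show ?thesis by blast
  next
    case False
    then show ?thesis
      using indep_subset_carrier by blast
  qed
  then have "pair_fin_digraph ?G \<and> E \<subseteq> pverts ?G \<and> B \<subseteq> pverts ?G \<and>
      (\<forall>I. indep I \<longleftrightarrow> I \<subseteq> E \<and> linked_into ?G I B)"
    using G by simp
  then show ?thesis
    unfolding gammoid_def using assms(1) by blast
qed

text \<open>Each \<open>x\<close> may use any hub in \<open>H\<close> or the vertex
  \<open>b (p x)\<close> shared by its class under \<open>p\<close>. Counting these vertices gives
  necessity; for sufficiency, one representative per class takes the shared vertex and the others
  are injected into \<open>H\<close>.\<close>

lemma hub_matching_iff: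
  assumes "finite I" "finite H" "inj_on b (p ` I)" "b ` p ` I \<inter> H = {}"
  shows "(\<exists>f. inj_on f I \<and> (\<forall>x\<in>I. f x \<in> H \<or> f x = b (p x))) \<longleftrightarrow> card I \<le> card H + card (p ` I)"
proof
  assume "\<exists>f. inj_on f I \<and> (\<forall>x\<in>I. f x \<in> H \<or> f x = b (p x))"
  then obtain f where f: "inj_on f I" "\<And>x. x \<in> I \<Longrightarrow> f x \<in> H \<or> f x = b (p x)" by blast
  have "card I \<le> card (H \<union> b ` p ` I)"
    using f assms(1,2) by (intro card_inj_on_le[of f]) auto
  also have "\<dots> \<le> card H + card (b ` p ` I)"
    by (rule card_Un_le)
  also have "card (b ` p ` I) = card (p ` I)"
    using assms(3) by (rule card_image)
  finally show "card I \<le> card H + card (p ` I)" .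
next
  assume le: "card I \<le> card H + card (p ` I)"
  \<comment> \<open>\<open>inv_into\<close> picks one representative of each class.\<close>
  define R where "R = inv_into I p ` p ` I"
  have R: "R \<subseteq> I" "p ` R = p ` I"
    by (auto simp: R_def inv_into_into f_inv_into_f image_image)
  have "card R = card (p ` I)"
    unfolding R_def by (intro card_image inj_on_inv_into order_refl)
  then have inj: "inj_on p R"
    using R assms(1) by (metis eq_card_imp_inj_on finite_subset)
  have "card (I - R) \<le> card H"
    using le \<open>card R = card (p ` I)\<close> R(1) assms(1) by (simp add: card_Diff_subset finite_subset)
  then obtain g where g: "g ` (I - R) \<subseteq> H" "inj_on g (I - R)"
    using card_le_inj[of "I - R" H] assms(1,2) by auto
  define f where "f x = (if x \<in> R then b (p x) else g x)" for x
  \<comment> \<open>Hubs and shared vertices are disjoint, so the value of \<open>f\<close> reveals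
    which branch produced it, and injectivity can be checked branch by branch.\<close>
  have fR: "f x \<in> H \<longleftrightarrow> x \<notin> R" if "x \<in> I" for x
  proof (cases "x \<in> R")
    case True
    have "b (p x) \<in> b ` p ` I"
      using that by blast
    then show ?thesis
      using True assms(4) by (auto simp: f_def)
  qed (use that g(1) in \<open>auto simp: f_def\<close>)
  have "inj_on f I"
  proof (rule inj_onI)
    fix x y assume xy: "x \<in> I" "y \<in> I" "f x = f y"
    then have iff: "x \<in> R \<longleftrightarrow> y \<in> R"
      using fR by metis
    show "x = y"
    proof (cases "x \<in> R")
      case True
      then have "p x = p y"
        using xy iff assms(3) by (auto simp: f_def dest: inj_onD)
      then show ?thesis
        using True iff inj by (auto dest: inj_onD)
    next
      case False
      then show ?thesis
        using xy iff g(2) by (auto simp: f_def dest: inj_onD)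
    qed
  qed
  moreover have "\<forall>x\<in>I. f x \<in> H \<or> f x = b (p x)"
    using fR by (auto simp: f_def)
  ultimately show "\<exists>f. inj_on f I \<and> (\<forall>x\<in>I. f x \<in> H \<or> f x = b (p x))"
    by blast
qed

section \<open>Complements of blocks as circuit-hyperplanes\<close>

definition ground :: "nat \<Rightarrow> nat set" where
  "ground n = {..<n * Suc n}"

text \<open>For positive \<open>n\<close> the blocks are the fibres of \<open>div n\<close>.\<close>

definition block :: "nat \<Rightarrow> nat \<Rightarrow> nat set" where
  "block n i = {n * i..<n * Suc i}"

definition block_complements :: "nat \<Rightarrow> nat set set" where
  "block_complements n = (\<lambda>i. ground n - block n i) ` {..n}"

lemma mem_block_iff: "0 < n \<Longrightarrow> x \<in> block n i \<longleftrightarrow> x div n = i"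
  by (auto simp: block_def div_nat_eqI dividend_less_times_div mult.commute)

lemma finite_ground: "finite (ground n)"
  by (simp add: ground_def)

lemma card_ground: "card (ground n) = n * n + n"
  by (simp add: ground_def)

lemma finite_block: "finite (block n i)"
  by (simp add: block_def)

lemma card_block: "card (block n i) = n"
  by (simp add: block_def)

lemma block_subset_ground: "i \<le> n \<Longrightarrow> block n i \<subseteq> ground n"
  by (auto simp: block_def ground_def intro: less_le_trans)

lemma block_disjoint: "0 < n \<Longrightarrow> i \<noteq> j \<Longrightarrow> block n i \<inter> block n j = {}"
  by (auto simp: mem_block_iff)

lemma div_le_if_mem_ground: "x \<in> ground n \<Longrightarrow> x div n \<le> n"
  by (simp add: ground_def less_mult_imp_div_less mult.commute flip: less_Suc_eq_le)

lemma card_block_complement: "i \<le> n \<Longrightarrow> card (ground n - block n i) = n * n"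
  by (simp add: card_Diff_subset block_subset_ground finite_block card_ground card_block)

lemma inj_on_block_complement:
  assumes "0 < n"
  shows "inj_on (\<lambda>i. ground n - block n i) {..n}"
proof (rule inj_onI)
  fix i j assume ij: "i \<in> {..n}" "j \<in> {..n}" "ground n - block n i = ground n - block n j"
  then have "block n i = block n j"
    using block_subset_ground[of i n] block_subset_ground[of j n] by (simp add: double_diff) blast
  moreover have "n * i \<in> block n i"
    using assms by (simp add: block_def)
  ultimately have "n * i \<in> block n j"
    by simp
  then show "i = j"
    using assms by (simp add: mem_block_iff)
qed

lemma block_complements_cover:
  assumes "0 < n" "A \<in> block_complements n" "B \<in> block_complements n" "A \<noteq> B"
  shows "A \<union> B = ground n"
proof -
  obtain i j where ij: "A = ground n - block n i" "B = ground n - block n j"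
    using assms(2,3) by (auto simp: block_complements_def)
  then have "block n i \<inter> block n j = {}"
    using assms(1,4) by (intro block_disjoint) auto
  then show ?thesis
    unfolding ij by blast
qed

text \<open>Two distinct complements cover the ground set, so by counting they meet in
  \<open>n * n - n\<close> elements; \<open>n \<ge> 2\<close> gives the gap of two.\<close>

lemma sparse_paving_blocks:
  assumes "n \<ge> 2"
  shows "sparse_paving (ground n) (block_complements n) (n * n)"
proof
  fix A B assume AB: "A \<in> block_complements n" "B \<in> block_complements n" "A \<noteq> B"
  have card: "card X = n * n" "finite X" if "X \<in> block_complements n" for X
    using that by (auto simp: block_complements_def card_block_complement finite_ground)
  have "card A + card B = card (A \<union> B) + card (A \<inter> B)"
    using AB card by (intro card_Un_Int) auto
  then show "card (A \<inter> B) + 2 \<le> n * n"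
    using AB card assms block_complements_cover[OF _ AB] by (simp add: card_ground)
qed (use assms in \<open>auto simp: block_complements_def card_block_complement finite_ground card_ground\<close>)

text \<open>The right side is the criterion of \<open>hub_matching_iff\<close> with
  \<open>n * n - Suc n\<close> hubs and the blocks as classes.\<close>

lemma ind_blocks_iff:
  assumes n: "n \<ge> 2" and I: "I \<subseteq> ground n"
  shows "sparse_paving.ind (ground n) (block_complements n) (n * n) I \<longleftrightarrow>
    card I \<le> n * n - Suc n + card ((\<lambda>x. x div n) ` I)"
proof -
  interpret sparse_paving "ground n" "block_complements n" "n * n"
    using n by (rule sparse_paving_blocks)
  define T where "T = (\<lambda>x. x div n) ` I"
  have T: "T \<subseteq> {..n}"
    using I div_le_if_mem_ground by (auto simp: T_def)
  then have finT: "finite T" and card_T: "card T \<le> Suc n"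
    using finite_subset card_mono[of "{..n}" T] by auto
  have missing: "I \<subseteq> ground n - block n i \<longleftrightarrow> i \<notin> T" for i
    using I n by (auto simp: T_def mem_block_iff)
  \<comment> \<open>This keeps the truncated subtraction exact.\<close>
  have sq: "Suc n \<le> n * n"
    using n mult_le_mono1[OF n, of n] by linarith
  have "ind I \<longleftrightarrow> card I \<le> n * n - Suc n + card T"
  proof
    assume "ind I"
    then have le: "card I \<le> n * n" and notin: "I \<notin> block_complements n"
      by (auto simp: ind_def)
    \<comment> \<open>If \<open>I\<close> meets all blocks, the bound is \<open>n * n\<close>. If it
      misses exactly one, it lies properly inside that complement. If it misses more, the block
      sizes alone suffice.\<close>
    consider "card T = Suc n" | "card T = n" | "card T < n"
      using card_T by linarith
    then show "card I \<le> n * n - Suc n + card T"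
    proof cases
      case 1
      with le sq show ?thesis by simp
    next
      case 2
      then have "T \<noteq> {..n}"
        using card_atMost[of n] by fastforce
      then obtain i where i: "i \<le> n" "i \<notin> T"
        using T by auto
      then have "I \<subset> ground n - block n i"
        using notin missing by (auto simp: block_complements_def)
      then have "card I < n * n"
        using card_block_complement[OF i(1)] finite_ground by (metis finite_Diff psubset_card_mono)
      with 2 sq show ?thesis by simp
    next
      case 3
      have "I \<subseteq> (\<Union>i\<in>T. block n i)"
        using n by (auto simp: T_def mem_block_iff)
      then have "card I \<le> card (\<Union>i\<in>T. block n i)"
        using finT finite_block by (intro card_mono) auto
      also have "\<dots> \<le> (\<Sum>i\<in>T. card (block n i))"
        by (rule card_UN_le[OF finT])
      also have "\<dots> = card T * n"
        by (simp add: card_block)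
      finally have I_le: "card I \<le> card T * n" .
      obtain k where k: "n = Suc k"
        using n by (cases n) auto
      \<comment> \<open>The goal reduces to \<open>k * k + Suc n \<le> n * n\<close>, which holds as
        \<open>k \<ge> 1\<close>.\<close>
      have "card T * k \<le> k * k"
        using 3 k by simp
      moreover have "card T * n = card T * k + card T" "n * n = k * k + 2 * k + 1"
        using k by simp_all
      ultimately have "card T * n + Suc n \<le> n * n + card T"
        using n k by linarith
      with I_le sq show ?thesis by linarith
    qed
  next
    assume le: "card I \<le> n * n - Suc n + card T"
    have "I \<notin> block_complements n"
    proof
      assume "I \<in> block_complements n"
      then obtain i where i: "i \<le> n" "I = ground n - block n i"
        by (auto simp: block_complements_def)
      \<comment> \<open>A complement has \<open>n * n\<close> elements but meets at most
        \<open>n\<close> blocks, so it violates the bound.\<close>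
      then have "T \<subseteq> {..n} - {i}"
        using T missing by blast
      then have "card T \<le> n"
        using card_mono[of "{..n} - {i}" T] i(1) by simp
      with le i sq card_block_complement[OF i(1)] show False by simp
    qed
    then show "ind I"
      using le card_T sq I by (simp add: ind_def)
  qed
  then show ?thesis
    by (simp add: T_def)
qed

lemma gammoid_blocks:
  assumes n: "n \<ge> 2"
  shows "gammoid (ground n) (sparse_paving.ind (ground n) (block_complements n) (n * n))"
proof -
  interpret sparse_paving "ground n" "block_complements n" "n * n"
    using n by (rule sparse_paving_blocks)
  \<comment> \<open>The targets are naturals beyond the ground set: \<open>b 0\<close> to
    \<open>b n\<close> are private to the blocks, and the remaining \<open>n * n - Suc n\<close>
    form \<open>H\<close>.\<close>
  define b where "b i = n * Suc n + i" for i
  define H where "H = {n * Suc n + Suc n..<n * Suc n + n * n}"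
  define B where "B = {n * Suc n..<n * Suc n + n * n}"
  define R where "R = {(x, y). x \<in> ground n \<and> (y \<in> H \<or> y = b (x div n))}"
  have sq: "Suc n \<le> n * n"
    using n mult_le_mono1[OF n, of n] by linarith
  show ?thesis
  proof (rule gammoid_bipartite[OF matroid_sparse_paving])
    show "finite B" "ground n \<inter> B = {}"
      by (auto simp: B_def ground_def)
    have "b (x div n) \<in> B" if "x \<in> ground n" for x
      using div_le_if_mem_ground[OF that] sq by (simp add: b_def B_def)
    then show "R \<subseteq> ground n \<times> B"
      by (auto simp: R_def H_def B_def)
    fix I assume I: "I \<subseteq> ground n"
    have "ind I \<longleftrightarrow> card I \<le> card H + card ((\<lambda>x. x div n) ` I)"
      using ind_blocks_iff[OF n I] by (simp add: H_def)
    also have "\<dots> \<longleftrightarrow> (\<exists>f. inj_on f I \<and> (\<forall>x\<in>I. f x \<in> H \<or> f x = b (x div n)))"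
    proof (rule hub_matching_iff[symmetric])
      show "finite I" using I finite_ground by (rule finite_subset)
      show "b ` (\<lambda>x. x div n) ` I \<inter> H = {}"
        using I div_le_if_mem_ground by (fastforce simp: b_def H_def)
    qed (auto simp: H_def b_def inj_on_def)
    also have "\<dots> \<longleftrightarrow> (\<exists>f. inj_on f I \<and> (\<forall>x\<in>I. (x, f x) \<in> R))"
      using I by (intro ex_cong1 conj_cong ball_cong refl) (auto simp: R_def)
    finally show "ind I \<longleftrightarrow> (\<exists>f. inj_on f I \<and> (\<forall>x\<in>I. (x, f x) \<in> R))" .
  qed
qed

lemma flatness_degree_blocks:
  assumes "n \<ge> 2"
  shows "flatness_degree (ground n) (sparse_paving.ind (ground n) (block_complements n) (n * n))
    = enat n"
proof -
  interpret sparse_paving "ground n" "block_complements n" "n * n"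
    using assms by (rule sparse_paving_blocks)
  have "card (block_complements n) = Suc n"
    unfolding block_complements_def using assms
    by (subst card_image[OF inj_on_block_complement]) auto
  then show ?thesis
    using assms block_complements_cover[of n] card_ground by (intro flatness_degree_covering) auto
qed

theorem theorem3:
  fixes n :: nat
  assumes "n \<ge> 2"
  shows "(\<exists>(N :: nat set) indep. matroid N indep \<and> flatness_degree N indep = enat n) \<and>
         (\<exists>(N :: nat set) indep. gammoid N indep \<and> flatness_degree N indep = enat n)"
proof -
  have "matroid (ground n) (sparse_paving.ind (ground n) (block_complements n) (n * n))"
    using gammoid_blocks[OF assms] by (simp add: gammoid_def)
  then show ?thesis
    using gammoid_blocks[OF assms] flatness_degree_blocks[OF assms] by blast
qed

end
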